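(* For every QCL-formula $F$ and every interpretation $\mathcal{I}\subseteq\mathcal{U}$, the value of the game $\mathbf{G}(\mathbf{P}:F,\mathcal{I})$ (defined in the context) is equal to the QCL satisfaction degree $\mathrm{deg}_\mathcal{I}(F)$.
   Context: QCL-formulas are built from propositional variables (from an infinite set $\mathcal{U}$) using $\neg$, $\wedge$, $\vee$ and the binary connective $\vec{\times}$ (ordered disjunction). Optionality: $\mathrm{opt}(a)=1$; $\mathrm{opt}(\neg F)=1$; $\mathrm{opt}(F\circ G)=\max(\mathrm{opt}(F),\mathrm{opt}(G))$ for $\circ\in\{\wedge,\vee\}$; $\mathrm{opt}(F\vec{\times}G)=\mathrm{opt}(F)+\mathrm{opt}(G)$. An interpretation is a set $\mathcal{I}\subseteq\mathcal{U}$. Satisfaction degree (values in $\mathbb{N}\cup\{\infty\}$): $\mathrm{deg}_\mathcal{I}(a)=1$ if $a\in\mathcal{I}$, $\infty$ otherwise; $\mathrm{deg}_\mathcal{I}(\neg F)=1$ if $\mathrm{deg}_\mathcal{I}(F)=\infty$, $\infty$ otherwise; $\mathrm{deg}_\mathcal{I}(F\wedge G)=\max(\mathrm{deg}_\mathcal{I}(F),\mathrm{deg}_\mathcal{I}(G))$; $\mathrm{deg}_\mathcal{I}(F\vee G)=\min(\mathrm{deg}_\mathcal{I}(F),\mathrm{deg}_\mathcal{I}(G))$; $\mathrm{deg}_\mathcal{I}(F\vec{\times}G)=\mathrm{deg}_\mathcal{I}(F)$ if $\mathrm{deg}_\mathcal{I}(F)<\infty$, $=\mathrm{opt}(F)+\mathrm{deg}_\mathcal{I}(G)$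 if $\mathrm{deg}_\mathcal{I}(F)=\infty$ and $\mathrm{deg}_\mathcal{I}(G)<\infty$, and $=\infty$ otherwise. The game $\mathbf{G}(\mathbf{P}:F,\mathcal{I})$ is played between two players, Me and You. Game trees: nodes are game states $\mathbf{Q}:H$ with $\mathbf{Q}\in\{\mathbf{P},\mathbf{O}\}$ (Me acting as proponent resp. opponent); write $\bar{\mathbf{P}}=\mathbf{O}$, $\bar{\mathbf{O}}=\mathbf{P}$. $T(\mathbf{Q}:a)$ is a single leaf $\mathbf{Q}:a$. $T(\mathbf{Q}:\neg G)$ has root $\mathbf{Q}:\neg G$ with single immediate subtree $T(\bar{\mathbf{Q}}:G)$. For $\circ\in\{\wedge,\vee,\vec{\times}\}$, $T(\mathbf{Q}:G_1\circ G_2)$ has root $\mathbf{Q}:G_1\circ G_2$ with immediate subtrees $T(\mathbf{Q}:G_1)$, $T(\mathbf{Q}:G_2)$. At a node $\mathbf{P}:G_1\wedge G_2$ You choose the successor, at $\mathbf{P}:G_1\vee G_2$ and $\mathbf{P}:G_1\vec{\times}G_2$ I choose; at $\mathbf{O}:G_1\wedge G_2$ I choose, at $\mathbf{O}:G_1\vee G_2$ and $\mathbf{O}:G_1\vec{\times}G_2$ You choose (negation nodes have a single successor). Leaves are outcomes. Preference relation on outcomes: $\ll_{\mathbf{P}:a}=\emptyset$; $\ll_{\mathbf{P}:\neg G}=\emptyset$; $\ll_{\mathbf{P}:G_1\wedge G_2}=\ll_{\mathbf{P}:G_1\vee G_2}=\ll_{\mathbf{P}:G_1}\cup\ll_{\mathbf{P}:G_2}$;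 $O_1\ll_{\mathbf{P}:G_1\vec{\times}G_2}O_2$ iff ($O_1$ is a leaf of $T(\mathbf{P}:G_2)$ and $O_2$ is a leaf of $T(\mathbf{P}:G_1)$) or $O_1\ll_{\mathbf{P}:G_j}O_2$ for some $j$; $\ll_{\mathbf{O}:H}=\emptyset$ for all $H$. Let $\ll=\ll_{\mathbf{P}:F}$. A leaf $\mathbf{P}:a$ is true iff $a\in\mathcal{I}$, a leaf $\mathbf{O}:a$ is true iff $a\notin\mathcal{I}$. For an outcome $O$, let $|\pi_\ll(O)|$ be the maximal $n$ such that there are pairwise distinct outcomes $O=O_1,\dots,O_n$ with $O_i\ll O_{i+1}$ for all $i<n$. Payoff: $d(O)=|\pi_\ll(O)|$ if $O$ is true and $d(O)=\infty$ if $O$ is false, with values in $\mathbb{N}\cup\{\infty\}$ ordered by $\preceq$, the inverse of the natural order (so $1$ is best for Me and $\infty$ worst). A strategy for Me is a set $\sigma$ of nodes containing the root such that for every $v\in\sigma$: if I choose at $v$ then at least one successor of $v$ is in $\sigma$, and if You choose at $v$ (or $v$ has a single successor) then all successors are in $\sigma$; strategies for You are defined symmetrically. Each pair $(\sigma_I,\sigma_Y)$ determines a unique outcome, with payoff $d(\sigma_I,\sigma_Y)$. The value of the game is $\max^{\preceq}_{\sigma_I}\min^{\preceq}_{\sigma_Y} d(\sigma_I,\sigma_Y)$ (which equals the corresponding minmax).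
   Formalization: A strategy is required to contain exactly one (not "at least one") successor at each of its nodes where its owner chooses; with "at least one", a pair of strategies need not determine a unique outcome (e.g. both leaves at P: a∨b), so the payoff would be undefined. *)

theory Defs
  imports
    "HOL-Library.Extended_Nat"
    "HOL-Library.Sublist"
    "HOL-Library.Infinite_Typeclass"
begin

section \<open>Qualitative Choice Logic\<close>

datatype 'a qcl =
    Var 'a
  | Neg "'a qcl"
  | Conj "'a qcl" "'a qcl"
  | Disj "'a qcl" "'a qcl"
  | OrdDisj "'a qcl" "'a qcl"

fun opt :: "'a qcl \<Rightarrow> nat" where
  "opt (Var a) = 1"
| "opt (Neg F) = 1"
| "opt (Conj F G) = max (opt F) (opt G)"
| "opt (Disj F G) = max (opt F) (opt G)"
| "opt (OrdDisj F G) = opt F + opt G"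

fun deg :: "'a set \<Rightarrow> 'a qcl \<Rightarrow> enat" where
  "deg I (Var a) = (if a \<in> I then 1 else \<infinity>)"
| "deg I (Neg F) = (if deg I F = \<infinity> then 1 else \<infinity>)"
| "deg I (Conj F G) = max (deg I F) (deg I G)"
| "deg I (Disj F G) = min (deg I F) (deg I G)"
| "deg I (OrdDisj F G) =
     (if deg I F < \<infinity> then deg I F
      else if deg I G < \<infinity> then enat (opt F) + deg I G
      else \<infinity>)"


section \<open>Game trees\<close>

datatype player = Me | You

text \<open>The role in which Me currently acts.\<close>

datatype role = Proponent | Opponent

fun dual :: "role \<Rightarrow> role" where
  "dual Proponent = Opponent"
| "dual Opponent = Proponent"

text \<open>
  The same game state may label several nodes of a tree (for instance when a variable occurs
  twice), so a node is a game state together with its address, the list of branch numbers leading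
  to it from the root. The single successor of a negation node is branch 0. Embedding
  an immediate subtree into the whole tree prepends its branch number to all addresses.
\<close>

type_synonym 'a node = "nat list \<times> role \<times> 'a qcl"

definition embed :: "nat \<Rightarrow> 'a node \<Rightarrow> 'a node" where
  "embed i v = (i # fst v, snd v)"

fun nodes :: "role \<Rightarrow> 'a qcl \<Rightarrow> 'a node set" where
  "nodes Q (Var a) = {([], Q, Var a)}"
| "nodes Q (Neg G) = insert ([], Q, Neg G) (embed 0 ` nodes (dual Q) G)"
| "nodes Q (Conj G1 G2) =
     insert ([], Q, Conj G1 G2) (embed 0 ` nodes Q G1 \<union> embed 1 ` nodes Q G2)"
| "nodes Q (Disj G1 G2) =
     insert ([], Q, Disj G1 G2) (embed 0 ` nodes Q G1 \<union> embed 1 ` nodes Q G2)"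
| "nodes Q (OrdDisj G1 G2) =
     insert ([], Q, OrdDisj G1 G2) (embed 0 ` nodes Q G1 \<union> embed 1 ` nodes Q G2)"

definition succs :: "role \<Rightarrow> 'a qcl \<Rightarrow> 'a node \<Rightarrow> 'a node set" where
  "succs Q F v = {w \<in> nodes Q F. \<exists>i. fst w = fst v @ [i]}"

definition leaves :: "role \<Rightarrow> 'a qcl \<Rightarrow> 'a node set" where
  "leaves Q F = {v \<in> nodes Q F. succs Q F v = {}}"

text \<open>\<^term>\<open>None\<close>: there is no choice to be made.\<close>

fun chooser :: "role \<Rightarrow> 'a qcl \<Rightarrow> player option" where
  "chooser Q (Var a) = None"
| "chooser Q (Neg G) = None"
| "chooser Proponent (Conj G1 G2) = Some You"
| "chooser Proponent (Disj G1 G2) = Some Me"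
| "chooser Proponent (OrdDisj G1 G2) = Some Me"
| "chooser Opponent (Conj G1 G2) = Some Me"
| "chooser Opponent (Disj G1 G2) = Some You"
| "chooser Opponent (OrdDisj G1 G2) = Some You"


section \<open>Preferences and payoff\<close>

definition embed_rel :: "nat \<Rightarrow> ('a node \<times> 'a node) set \<Rightarrow> ('a node \<times> 'a node) set" where
  "embed_rel i r = {(embed i v, embed i w) | v w. (v, w) \<in> r}"

text \<open>\<^term>\<open>(v, w) \<in> pref Q F\<close> means that Me prefers the outcome \<^term>\<open>w\<close> to \<^term>\<open>v\<close>.\<close>

fun pref :: "role \<Rightarrow> 'a qcl \<Rightarrow> ('a node \<times> 'a node) set" where
  "pref Opponent F = {}"
| "pref Proponent (Var a) = {}"
| "pref Proponent (Neg G) = {}"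
| "pref Proponent (Conj G1 G2) =
     embed_rel 0 (pref Proponent G1) \<union> embed_rel 1 (pref Proponent G2)"
| "pref Proponent (Disj G1 G2) =
     embed_rel 0 (pref Proponent G1) \<union> embed_rel 1 (pref Proponent G2)"
| "pref Proponent (OrdDisj G1 G2) =
     (embed 1 ` leaves Proponent G2) \<times> (embed 0 ` leaves Proponent G1)
     \<union> embed_rel 0 (pref Proponent G1) \<union> embed_rel 1 (pref Proponent G2)"

definition pi_length :: "role \<Rightarrow> 'a qcl \<Rightarrow> 'a node \<Rightarrow> nat" where
  "pi_length Q F v =
     Max {length vs | vs. vs \<noteq> [] \<and> hd vs = v \<and> distinct vs \<and> set vs \<subseteq> leaves Q F \<and>
                          successively (\<lambda>x y. (x, y) \<in> pref Q F) vs}"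

text \<open>Only leaves, which are labelled by variables, are ever true.\<close>

fun true_leaf :: "'a set \<Rightarrow> 'a node \<Rightarrow> bool" where
  "true_leaf I (p, Proponent, Var a) \<longleftrightarrow> a \<in> I"
| "true_leaf I (p, Opponent, Var a) \<longleftrightarrow> a \<notin> I"
| "true_leaf I (p, _, _) \<longleftrightarrow> False"

definition payoff :: "role \<Rightarrow> 'a qcl \<Rightarrow> 'a set \<Rightarrow> 'a node \<Rightarrow> enat" where
  "payoff Q F I v = (if true_leaf I v then enat (pi_length Q F v) else \<infinity>)"


section \<open>Strategies and the value of the game\<close>

text \<open>
  A strategy selects exactly one successor at each of its nodes where its owner chooses; this is
  what makes the outcome of two opposing strategies unique. Nodes that cannot be reached from the
  root within the strategy are permitted, and therefore \<open>outcome\<close> below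
  requires the whole path to the leaf to lie in both strategies.
\<close>

definition strategies :: "player \<Rightarrow> role \<Rightarrow> 'a qcl \<Rightarrow> 'a node set set" where
  "strategies X Q F =
     {\<sigma>. \<sigma> \<subseteq> nodes Q F \<and> ([], Q, F) \<in> \<sigma> \<and>
          (\<forall>(p, R, H)\<in>\<sigma>.
             if chooser R H = Some X then \<exists>!w. w \<in> succs Q F (p, R, H) \<and> w \<in> \<sigma>
             else succs Q F (p, R, H) \<subseteq> \<sigma>)}"

definition is_outcome ::
  "role \<Rightarrow> 'a qcl \<Rightarrow> 'a node set \<Rightarrow> 'a node set \<Rightarrow> 'a node \<Rightarrow> bool" where
  "is_outcome Q F \<sigma> \<tau> v \<longleftrightarrow>
     v \<in> leaves Q F \<and> (\<forall>w\<in>nodes Q F. prefix (fst w) (fst v) \<longrightarrow> w \<in> \<sigma> \<inter> \<tau>)"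

definition outcome :: "role \<Rightarrow> 'a qcl \<Rightarrow> 'a node set \<Rightarrow> 'a node set \<Rightarrow> 'a node" where
  "outcome Q F \<sigma> \<tau> = (THE v. is_outcome Q F \<sigma> \<tau> v)"

text \<open>
  Payoffs are ranked by the inverse of the order on \<^typ>\<open>enat\<close>: Me maximizing is
  \<^const>\<open>Min\<close> and You minimizing is \<^const>\<open>Max\<close>. All sets involved are finite and nonempty, see
  \<open>finite_strategies\<close> and \<open>strategies_nonempty\<close>.
\<close>

definition game_value :: "role \<Rightarrow> 'a qcl \<Rightarrow> 'a set \<Rightarrow> enat" where
  "game_value Q F I =
     Min ((\<lambda>\<sigma>. Max ((\<lambda>\<tau>. payoff Q F I (outcome Q F \<sigma> \<tau>)) ` strategies You Q F))
          ` strategies Me Q F)"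


section \<open>Well-definedness\<close>

lemma finite_nodes: "finite (nodes Q F)"
  by (induction F arbitrary: Q) auto

lemma finite_strategies: "finite (strategies X Q F)"
  by (rule finite_subset[of _ "Pow (nodes Q F)"]) (auto simp: strategies_def finite_nodes)

lemma root_in_nodes: "([], Q, F) \<in> nodes Q F"
  by (cases F) auto

lemma embed_image_iff: "(p, s) \<in> embed i ` A \<longleftrightarrow> (\<exists>q. p = i # q \<and> (q, s) \<in> A)"
  by (force simp: embed_def)

lemma node_unique:
  assumes "v \<in> nodes Q F" "w \<in> nodes Q F" "fst v = fst w"
  shows "v = w"
  using assms
proof (induction F arbitrary: Q v w)
  case (Neg F)
  then show ?case by (fastforce simp: embed_def prod_eq_iff)
next
  case (Conj F1 F2)
  then show ?case by (fastforce simp: embed_def prod_eq_iff)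
next
  case (Disj F1 F2)
  then show ?case by (fastforce simp: embed_def prod_eq_iff)
next
  case (OrdDisj F1 F2)
  then show ?case by (fastforce simp: embed_def prod_eq_iff)
qed auto

lemma node_prefix:
  assumes "v \<in> nodes Q F" "prefix p (fst v)"
  shows "\<exists>s. (p, s) \<in> nodes Q F"
proof -
  have "(q, t) \<in> nodes Q F \<Longrightarrow> prefix p q \<Longrightarrow> \<exists>R H. (p, R, H) \<in> nodes Q F" for q t
  proof (induction F arbitrary: Q p q)
    case (Neg F)
    then show ?case by (cases p) (auto simp: embed_image_iff prefix_Cons)
  next
    case (Conj F1 F2)
    then show ?case by (cases p) (auto simp: embed_image_iff prefix_Cons)
  next
    case (Disj F1 F2)
    then show ?case by (cases p) (auto simp: embed_image_iff prefix_Cons)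
  next
    case (OrdDisj F1 F2)
    then show ?case by (cases p) (auto simp: embed_image_iff prefix_Cons)
  qed auto
  from this[of "fst v" "snd v"] assms show ?thesis by auto
qed

lemma nodes_extension:
  "(p, R, H) \<in> nodes Q F \<Longrightarrow> (p @ q, s) \<in> nodes Q F \<longleftrightarrow> (q, s) \<in> nodes R H"
  by (induction F arbitrary: Q p) (auto simp: embed_image_iff)

lemma nodes_root: "([], s) \<in> nodes Q F \<longleftrightarrow> s = (Q, F)"
  by (cases F) (auto simp: embed_image_iff)

lemma succs_eq:
  assumes "(p, R, H) \<in> nodes Q F"
  shows "succs Q F (p, R, H) =
    (case H of Var a \<Rightarrow> {}
     | Neg G \<Rightarrow> {(p @ [0], dual R, G)}
     | Conj G1 G2 \<Rightarrow> {(p @ [0], R, G1), (p @ [1], R, G2)}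
     | Disj G1 G2 \<Rightarrow> {(p @ [0], R, G1), (p @ [1], R, G2)}
     | OrdDisj G1 G2 \<Rightarrow> {(p @ [0], R, G1), (p @ [1], R, G2)})"
proof -
  have "succs Q F (p, R, H) = {(p @ [i], s) | i s. ([i], s) \<in> nodes R H}"
    using nodes_extension[OF assms] by (fastforce simp: succs_def)
  also have "\<dots> = (\<lambda>(q, s). (p @ q, s)) ` {([i], s) | i s. ([i], s) \<in> nodes R H}"
    by (auto simp: image_iff)
  also have "{([i], s) | i s. ([i], s) \<in> nodes R H} =
    (case H of Var a \<Rightarrow> {}
     | Neg G \<Rightarrow> {([0], dual R, G)}
     | Conj G1 G2 \<Rightarrow> {([0], R, G1), ([1], R, G2)}
     | Disj G1 G2 \<Rightarrow> {([0], R, G1), ([1], R, G2)}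
     | OrdDisj G1 G2 \<Rightarrow> {([0], R, G1), ([1], R, G2)})"
    by (cases H) (auto simp: embed_image_iff nodes_root)
  finally show ?thesis
    by (cases H) auto
qed

lemma strategies_nonempty: "strategies X Q F \<noteq> {}"
proof -
  define \<sigma> where "\<sigma> = {v \<in> nodes Q F. \<forall>(p, R, H)\<in>nodes Q F.
     chooser R H = Some X \<longrightarrow> \<not> prefix (p @ [1]) (fst v)}"
  have "if chooser R H = Some X then \<exists>!w. w \<in> succs Q F (p, R, H) \<and> w \<in> \<sigma>
        else succs Q F (p, R, H) \<subseteq> \<sigma>" if v: "(p, R, H) \<in> \<sigma>" for p R H
  proof (cases "chooser R H = Some X")
    case True
    have n: "(p, R, H) \<in> nodes Q F" using v by (simp add: \<sigma>_def)
    obtain G1 G2 where S: "succs Q F (p, R, H) = {(p @ [0], R, G1), (p @ [1], R, G2)}"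
      using succs_eq[OF n] True by (cases H) auto
    then have m: "(p @ [0], R, G1) \<in> nodes Q F" by (auto simp: succs_def)
    have "(p @ [0], R, G1) \<in> \<sigma>"
      using v m by (auto simp: \<sigma>_def)
    moreover have "(p @ [1], R, G2) \<notin> \<sigma>"
      using n True by (force simp: \<sigma>_def)
    ultimately have "\<exists>!w. w \<in> succs Q F (p, R, H) \<and> w \<in> \<sigma>"
      unfolding S by (intro ex1I[of _ "(p @ [0], R, G1)"]) auto
    with True show ?thesis by simp
  next
    case False
    have n: "(p, R, H) \<in> nodes Q F" using v by (simp add: \<sigma>_def)
    have "w \<in> \<sigma>" if w: "w \<in> succs Q F (p, R, H)" for w
    proof -
      obtain i where i: "fst w = p @ [i]" "w \<in> nodes Q F" using w by (auto simp: succs_def)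
      have "\<not> prefix (p' @ [1]) (fst w)"
        if u: "(p', R', H') \<in> nodes Q F" "chooser R' H' = Some X" for p' R' H'
      proof
        assume "prefix (p' @ [1]) (fst w)"
        moreover have "\<not> prefix (p' @ [1]) p" using v u by (auto simp: \<sigma>_def)
        ultimately have "p' = p" using i by simp
        then have "(p', R', H') = (p, R, H)" using node_unique[OF u(1) n] by simp
        with u False show False by simp
      qed
      with i show ?thesis by (auto simp: \<sigma>_def)
    qed
    with False show ?thesis by auto
  qed
  moreover have "\<sigma> \<subseteq> nodes Q F" "([], Q, F) \<in> \<sigma>"
    by (auto simp: \<sigma>_def root_in_nodes)
  ultimately have "\<sigma> \<in> strategies X Q F"
    unfolding strategies_def by blast
  then show ?thesis by blast
qed

lemma strategies_common_succ:
  assumes \<sigma>: "\<sigma> \<in> strategies Me Q F" and \<tau>: "\<tau> \<in> strategies You Q F"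
    and v: "v \<in> \<sigma> \<inter> \<tau>" and nl: "v \<notin> leaves Q F"
  shows "\<exists>!w. w \<in> succs Q F v \<and> w \<in> \<sigma> \<inter> \<tau>"
proof -
  obtain p R H where pRH: "v = (p, R, H)" by (cases v)
  have n: "v \<in> nodes Q F" using \<sigma> v by (auto simp: strategies_def)
  have ne: "succs Q F v \<noteq> {}" using n nl by (auto simp: leaves_def)
  have 1: "if chooser R H = Some Me then \<exists>!w. w \<in> succs Q F v \<and> w \<in> \<sigma>
        else succs Q F v \<subseteq> \<sigma>"
    using \<sigma> v unfolding pRH strategies_def by fast
  have 2: "if chooser R H = Some You then \<exists>!w. w \<in> succs Q F v \<and> w \<in> \<tau>
        else succs Q F v \<subseteq> \<tau>"
    using \<tau> v unfolding pRH strategies_def by fast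
  consider "chooser R H = Some Me" | "chooser R H = Some You" | "chooser R H = None"
    by (metis not_None_eq player.exhaust)
  then show ?thesis
  proof cases
    case 3
    then obtain G where "H = Neg G"
      using ne succs_eq[OF n[unfolded pRH]] unfolding pRH by (cases H; cases R) auto
    then have "succs Q F v = {(p @ [0], dual R, G)}"
      using succs_eq[OF n[unfolded pRH]] unfolding pRH by simp
    with 1 2 3 show ?thesis by auto
  qed (use 1 2 in auto)
qed

lemma outcome_unique:
  assumes \<sigma>: "\<sigma> \<in> strategies Me Q F" and \<tau>: "\<tau> \<in> strategies You Q F"
  shows "\<exists>!v. is_outcome Q F \<sigma> \<tau> v"
proof -
  define S where "S = {v \<in> nodes Q F. \<forall>w\<in>nodes Q F. prefix (fst w) (fst v) \<longrightarrow> w \<in> \<sigma> \<inter> \<tau>}"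
  have "finite S" by (simp add: S_def finite_nodes)
  moreover have "([], Q, F) \<in> S"
    using \<sigma> \<tau> by (auto simp: S_def root_in_nodes strategies_def nodes_root)
  ultimately obtain v where v: "v \<in> S" "\<And>w. w \<in> S \<Longrightarrow> length (fst w) \<le> length (fst v)"
    using obtains_MAX[of S "\<lambda>v. length (fst v)"] by (metis Max_ge empty_iff finite_imageI imageI)
  have vst: "v \<in> \<sigma> \<inter> \<tau>" using v(1) by (auto simp: S_def)
  have "v \<in> leaves Q F"
  proof (rule ccontr)
    assume "v \<notin> leaves Q F"
    then obtain w where w: "w \<in> succs Q F v" "w \<in> \<sigma> \<inter> \<tau>"
      using strategies_common_succ[OF \<sigma> \<tau> vst] by blast
    then obtain i where i: "fst w = fst v @ [i]" "w \<in> nodes Q F" by (auto simp: succs_def)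
    have "u \<in> \<sigma> \<inter> \<tau>" if u: "u \<in> nodes Q F" "prefix (fst u) (fst w)" for u
    proof (cases "fst u = fst w")
      case True
      then show ?thesis using node_unique[OF u(1) i(2)] w by simp
    next
      case False
      then have "prefix (fst u) (fst v)" using u i by simp
      then show ?thesis using u v(1) by (auto simp: S_def)
    qed
    then have "w \<in> S" using i by (simp add: S_def)
    then show False using v(2)[of w] i by simp
  qed
  then have ex: "is_outcome Q F \<sigma> \<tau> v" using v(1) by (auto simp: is_outcome_def S_def)
  moreover have "v' = v''" if a: "is_outcome Q F \<sigma> \<tau> v'" and b: "is_outcome Q F \<sigma> \<tau> v''" for v' v''
  proof (rule ccontr)
    assume ne: "v' \<noteq> v''"
    have n: "v' \<in> nodes Q F" "v'' \<in> nodes Q F" using a b by (auto simp: is_outcome_def leaves_def)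
    have np: "\<not> prefix (fst x) (fst y)"
      if x: "is_outcome Q F \<sigma> \<tau> x" and y: "is_outcome Q F \<sigma> \<tau> y" and "x \<noteq> y" for x y
    proof
      assume "prefix (fst x) (fst y)"
      moreover have ny: "x \<in> nodes Q F" "y \<in> nodes Q F"
        using x y by (auto simp: is_outcome_def leaves_def)
      then have "fst x \<noteq> fst y" using node_unique \<open>x \<noteq> y\<close> by blast
      ultimately obtain i r where "fst y = fst x @ [i] @ r"
        by (metis append_Cons append_Nil append_Nil2 neq_Nil_conv prefixE)
      then have "prefix (fst x @ [i]) (fst y)" by simp
      then obtain s where "(fst x @ [i], s) \<in> nodes Q F" using node_prefix ny by blast
      then have "(fst x @ [i], s) \<in> succs Q F x" by (simp add: succs_def)
      then show False using x by (auto simp: is_outcome_def leaves_def)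
    qed
    have "fst v' \<parallel> fst v''" using np[OF a b] np[OF b a] ne by auto
    then obtain c i j r s where c: "i \<noteq> j" "fst v' = c @ i # r" "fst v'' = c @ j # s"
      using parallel_decomp by blast
    then have pr: "prefix c (fst v')" "prefix (c @ [i]) (fst v')" "prefix (c @ [j]) (fst v'')"
      by auto
    obtain sc si sj where m: "(c, sc) \<in> nodes Q F" "(c @ [i], si) \<in> nodes Q F" "(c @ [j], sj) \<in> nodes Q F"
      using node_prefix n pr by meson
    have "(c, sc) \<in> \<sigma> \<inter> \<tau>" "(c @ [i], si) \<in> \<sigma> \<inter> \<tau>" "(c @ [j], sj) \<in> \<sigma> \<inter> \<tau>"
      using a b m pr unfolding is_outcome_def by (metis fst_conv)+
    moreover have s: "(c @ [i], si) \<in> succs Q F (c, sc)" "(c @ [j], sj) \<in> succs Q F (c, sc)"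
      using m by (auto simp: succs_def)
    moreover have "(c, sc) \<notin> leaves Q F" using s by (auto simp: leaves_def)
    ultimately have "(c @ [i], si) = (c @ [j], sj)"
      using strategies_common_succ[OF \<sigma> \<tau>] by blast
    with c(1) show False by simp
  qed
  ultimately show ?thesis by blast
qed

end

theory Submission
  imports Defs
begin

text \<open>
  Backward induction computes the value of the game on a tree for any payoff function on the
  leaves: a positional choice of an optimal successor at the nodes of one player guarantees that
  player the backward induction value. For the payoff of the theorem, the length of a longest
  improving chain from a leaf is given by a rank that adds \<open>opt G1\<close> on the second branch of an
  ordered disjunction, since \<open>opt G1\<close> is the length of a longest chain in \<open>pref Proponent G1\<close>.
  Below a negation all true leaves have the same payoff, so the game there is classical.
\<close>

section \<open>Backward induction\<close>

text \<open>Leaf payoffs are addressed relative to the current subtree, so entering branch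
  \<open>i\<close> precomposes them with \<open>embed i\<close>. Small payoffs are good for Me,
  hence \<open>min\<close> where Me chooses and \<open>max\<close> where You choose.\<close>

fun back_value :: "role \<Rightarrow> 'a qcl \<Rightarrow> ('a node \<Rightarrow> enat) \<Rightarrow> enat" where
  "back_value Q (Var a) f = f ([], Q, Var a)"
| "back_value Q (Neg G) f = back_value (dual Q) G (f \<circ> embed 0)"
| "back_value Q (Conj G1 G2) f =
     (if Q = Proponent then max else min)
       (back_value Q G1 (f \<circ> embed 0)) (back_value Q G2 (f \<circ> embed 1))"
| "back_value Q (Disj G1 G2) f =
     (if Q = Proponent then min else max)
       (back_value Q G1 (f \<circ> embed 0)) (back_value Q G2 (f \<circ> embed 1))"
| "back_value Q (OrdDisj G1 G2) f =
     (if Q = Proponent then min else max)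
       (back_value Q G1 (f \<circ> embed 0)) (back_value Q G2 (f \<circ> embed 1))"

fun node_value :: "('a node \<Rightarrow> enat) \<Rightarrow> 'a node \<Rightarrow> enat" where
  "node_value f (p, R, H) = back_value R H (\<lambda>(q, s). f (p @ q, s))"

text \<open>One order for both players, so that a single optimality proof yields both bounds on the
  minimax value.\<close>

fun at_least_as_good :: "player \<Rightarrow> enat \<Rightarrow> enat \<Rightarrow> bool" where
  "at_least_as_good Me a b \<longleftrightarrow> a \<le> b"
| "at_least_as_good You a b \<longleftrightarrow> b \<le> a"

lemma at_least_as_good_refl: "at_least_as_good X a a"
  by (cases X) auto

lemma at_least_as_good_trans:
  "at_least_as_good X a b \<Longrightarrow> at_least_as_good X b c \<Longrightarrow> at_least_as_good X a c"
  by (cases X) auto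

section \<open>Comparing the value of a node with those of its successors\<close>

lemma node_value_branch:
  "node_value f (p @ [i], R, H) = back_value R H ((\<lambda>(q, s). f (p @ q, s)) \<circ> embed i)"
proof -
  have "(\<lambda>(q, s). f ((p @ [i]) @ q, s)) = (\<lambda>(q, s). f (p @ q, s)) \<circ> embed i"
    by (auto simp: embed_def)
  then show ?thesis by simp
qed

lemma succ_value_chooser:
  assumes "(p, R, H) \<in> nodes Q F" "chooser R H = Some X"
  shows "\<exists>w\<in>succs Q F (p, R, H).
    at_least_as_good X (node_value f w) (node_value f (p, R, H))"
  unfolding succs_eq[OF assms(1)] using assms(2)
  \<comment> \<open>\<open>node_value\<close> is unfolded at the address \<open>p\<close> only, so
    that the longer addresses of the successors are left to
    \<open>node_value_branch\<close>.\<close>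
  by (cases H; cases R)
    (auto simp: node_value_branch min_def max_def simp del: node_value.simps(1)
          simp: node_value.simps[of f p])

text \<open>If the other player chooses, the value is that player's optimum and thus the worst case
  for \<open>X\<close>; without a choice there is at most one successor, of the same value.\<close>

lemma succ_value_not_chooser:
  assumes "(p, R, H) \<in> nodes Q F" "chooser R H \<noteq> Some X" "w \<in> succs Q F (p, R, H)"
  shows "at_least_as_good X (node_value f w) (node_value f (p, R, H))"
  using assms(2,3) unfolding succs_eq[OF assms(1)]
  by (cases H; cases R; cases X)
    (auto simp: node_value_branch simp del: node_value.simps(1)
          simp: node_value.simps[of f p])

section \<open>Strategies induced by a choice of successors\<close>

lemma strategy_of_choice:
  assumes c: "\<And>p R H. (p, R, H) \<in> nodes Q F \<Longrightarrow> chooser R H = Some X \<Longrightarrow>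
    c (p, R, H) \<in> succs Q F (p, R, H)"
  shows "\<exists>\<sigma>\<in>strategies X Q F. \<forall>(p, R, H)\<in>\<sigma>. chooser R H = Some X \<longrightarrow>
    succs Q F (p, R, H) \<inter> \<sigma> = {c (p, R, H)}"
proof -
  \<comment> \<open>A node is kept if its path leaves every earlier node of \<open>X\<close> along
    the branch that \<open>c\<close> picks; \<open>prefix\<close> expresses this through
    addresses.\<close>
  define \<sigma> where "\<sigma> = {v \<in> nodes Q F. \<forall>(p, R, H)\<in>nodes Q F. chooser R H = Some X \<longrightarrow>
    (\<forall>i. prefix (p @ [i]) (fst v) \<longrightarrow> fst (c (p, R, H)) = p @ [i])}"
  have succ_in: "w \<in> \<sigma>"
    if v: "v \<in> \<sigma>" and w: "w \<in> succs Q F v"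
      and ch: "chooser (fst (snd v)) (snd (snd v)) = Some X \<Longrightarrow> w = c v" for v w
  proof -
    obtain i where i: "fst w = fst v @ [i]" "w \<in> nodes Q F" using w by (auto simp: succs_def)
    have n: "v \<in> nodes Q F" using v by (simp add: \<sigma>_def)
    have "fst (c (p, R, H)) = p @ [j]"
      if u: "(p, R, H) \<in> nodes Q F" "chooser R H = Some X" "prefix (p @ [j]) (fst w)" for p R H j
    proof (cases "prefix (p @ [j]) (fst v)")
      case True
      then show ?thesis using v u by (auto simp: \<sigma>_def)
    next
      case False
      \<comment> \<open>Only the last edge of the path to \<open>w\<close> is new, and it leaves
        \<open>v\<close> itself.\<close>
      then have pj: "p @ [j] = fst w" "p = fst v" using u(3) i by auto
      then have "v = (p, R, H)" using node_unique[OF n u(1)] by simp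
      then show ?thesis using ch u(2) pj by (metis fst_conv snd_conv)
    qed
    with i show ?thesis by (auto simp: \<sigma>_def)
  qed
  have inter: "succs Q F (p, R, H) \<inter> \<sigma> = {c (p, R, H)}"
    if v: "(p, R, H) \<in> \<sigma>" and X: "chooser R H = Some X" for p R H
  proof -
    have n: "(p, R, H) \<in> nodes Q F" using v by (simp add: \<sigma>_def)
    have "w = c (p, R, H)" if w: "w \<in> succs Q F (p, R, H)" "w \<in> \<sigma>" for w
    proof -
      obtain i where i: "fst w = p @ [i]" "w \<in> nodes Q F" using w by (auto simp: succs_def)
      then have "fst (c (p, R, H)) = fst w" using w(2) n X by (fastforce simp: \<sigma>_def)
      moreover have "c (p, R, H) \<in> nodes Q F" using c[OF n X] by (simp add: succs_def)
      ultimately show ?thesis using node_unique i(2) by metis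
    qed
    moreover have "c (p, R, H) \<in> \<sigma>" using succ_in[OF v c[OF n X]] by simp
    ultimately show ?thesis using c[OF n X] by blast
  qed
  have "if chooser R H = Some X then \<exists>!w. w \<in> succs Q F (p, R, H) \<and> w \<in> \<sigma>
        else succs Q F (p, R, H) \<subseteq> \<sigma>" if v: "(p, R, H) \<in> \<sigma>" for p R H
  proof (cases "chooser R H = Some X")
    case True
    have "\<exists>!w. w \<in> succs Q F (p, R, H) \<inter> \<sigma>" unfolding inter[OF v True] by simp
    then show ?thesis using True by simp
  next
    case False
    then show ?thesis using succ_in[OF v] by auto
  qed
  moreover have "\<sigma> \<subseteq> nodes Q F" "([], Q, F) \<in> \<sigma>"
    by (auto simp: \<sigma>_def root_in_nodes)
  ultimately have "\<sigma> \<in> strategies X Q F"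
    unfolding strategies_def by blast
  then show ?thesis
    by (rule bexI[rotated]) (clarify, rule inter)
qed

lemma leaves_eq: "leaves Q F = {v \<in> nodes Q F. \<exists>a. snd (snd v) = Var a}"
proof -
  have "succs Q F (p, R, H) = {} \<longleftrightarrow> (\<exists>a. H = Var a)" if "(p, R, H) \<in> nodes Q F" for p R H
    using succs_eq[OF that] by (cases H) auto
  then have "succs Q F v = {} \<longleftrightarrow> (\<exists>a. snd (snd v) = Var a)" if "v \<in> nodes Q F" for v
    using that by (metis prod.collapse)
  then show ?thesis unfolding leaves_def by blast
qed

text \<open>Under optimal choices the node value never gets worse for \<open>X\<close> along a path
  inside \<sigma>, whatever the other player does; at the root it is
  \<open>back_value Q F f\<close>, at a leaf it is the payoff.\<close>

lemma optimal_strategy: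
  "\<exists>\<sigma>\<in>strategies X Q F. \<forall>v\<in>leaves Q F.
     (\<forall>w\<in>nodes Q F. prefix (fst w) (fst v) \<longrightarrow> w \<in> \<sigma>) \<longrightarrow>
     at_least_as_good X (f v) (back_value Q F f)"
proof -
  define c where "c v = (SOME w. w \<in> succs Q F v \<and>
    at_least_as_good X (node_value f w) (node_value f v))" for v
  have c: "c (p, R, H) \<in> succs Q F (p, R, H) \<and>
      at_least_as_good X (node_value f (c (p, R, H))) (node_value f (p, R, H))"
    if "(p, R, H) \<in> nodes Q F" "chooser R H = Some X" for p R H
    unfolding c_def by (rule someI_ex) (use succ_value_chooser[OF that] in blast)
  obtain \<sigma> where \<sigma>: "\<sigma> \<in> strategies X Q F"
    and \<sigma>c: "\<forall>(p, R, H)\<in>\<sigma>. chooser R H = Some X \<longrightarrow>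
      succs Q F (p, R, H) \<inter> \<sigma> = {c (p, R, H)}"
    using strategy_of_choice[of Q F X c] c by blast
  have step: "at_least_as_good X (node_value f w) (node_value f v)"
    if "v \<in> nodes Q F" "v \<in> \<sigma>" "w \<in> succs Q F v" "w \<in> \<sigma>" for v w
  proof -
    obtain p R H where v: "v = (p, R, H)" by (cases v)
    show ?thesis
    proof (cases "chooser R H = Some X")
      case True
      then have "w = c v" using \<sigma>c that v by blast
      then show ?thesis using c that v True by blast
    next
      case False
      then show ?thesis using succ_value_not_chooser that v by blast
    qed
  qed
  have path: "at_least_as_good X (node_value f (p, s)) (back_value Q F f)"
    if "(p, s) \<in> nodes Q F" "\<forall>w\<in>nodes Q F. prefix (fst w) p \<longrightarrow> w \<in> \<sigma>" for p s
    using that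
  \<comment> \<open>Addresses grow at their end as play descends from the root, hence the reversed
    list induction.\<close>
  proof (induction p arbitrary: s rule: rev_induct)
    case Nil
    then show ?case by (auto simp: nodes_root at_least_as_good_refl)
  next
    case (snoc i p)
    obtain t where t: "(p, t) \<in> nodes Q F"
      using node_prefix[OF snoc.prems(1), of p] by auto
    have "at_least_as_good X (node_value f (p @ [i], s)) (node_value f (p, t))"
      by (rule step) (use snoc.prems t in \<open>auto simp: succs_def\<close>)
    moreover have "at_least_as_good X (node_value f (p, t)) (back_value Q F f)"
      using snoc.prems by (intro snoc.IH t) auto
    ultimately show ?case by (rule at_least_as_good_trans)
  qed
  have "at_least_as_good X (f v) (back_value Q F f)"
    if v: "v \<in> leaves Q F" "\<forall>w\<in>nodes Q F. prefix (fst w) (fst v) \<longrightarrow> w \<in> \<sigma>" for v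
  proof -
    have "node_value f v = f v" using v(1) by (cases v) (auto simp: leaves_eq)
    moreover have "v \<in> nodes Q F" using v(1) by (simp add: leaves_def)
    ultimately show ?thesis using path[of "fst v" "snd v"] v(2) by simp
  qed
  with \<sigma> show ?thesis by blast
qed

section \<open>The minimax value\<close>

lemma is_outcome_outcome:
  assumes "\<sigma> \<in> strategies Me Q F" "\<tau> \<in> strategies You Q F"
  shows "is_outcome Q F \<sigma> \<tau> (outcome Q F \<sigma> \<tau>)"
  unfolding outcome_def by (rule theI'[OF outcome_unique[OF assms]])

text \<open>The optimal strategy of Me caps its own \<open>Max\<close>, hence the
  \<open>Min\<close>; the one of You is a reply that bounds every \<open>Max\<close> from
  below.\<close>

lemma minimax_eq_back_value:
  "Min ((\<lambda>\<sigma>. Max ((\<lambda>\<tau>. f (outcome Q F \<sigma> \<tau>)) ` strategies You Q F)) ` strategies Me Q F)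
     = back_value Q F f"
proof (rule antisym)
  obtain \<sigma> where \<sigma>: "\<sigma> \<in> strategies Me Q F" and
    opt: "\<And>v. v \<in> leaves Q F \<Longrightarrow> (\<forall>w\<in>nodes Q F. prefix (fst w) (fst v) \<longrightarrow> w \<in> \<sigma>) \<Longrightarrow>
      f v \<le> back_value Q F f"
    using optimal_strategy[of Me Q F f] by auto
  have "f (outcome Q F \<sigma> \<tau>) \<le> back_value Q F f" if "\<tau> \<in> strategies You Q F" for \<tau>
    using is_outcome_outcome[OF \<sigma> that] by (intro opt) (auto simp: is_outcome_def)
  then have "Max ((\<lambda>\<tau>. f (outcome Q F \<sigma> \<tau>)) ` strategies You Q F) \<le> back_value Q F f"
    by (subst Max_le_iff) (auto simp: finite_strategies strategies_nonempty)
  then show "Min ((\<lambda>\<sigma>. Max ((\<lambda>\<tau>. f (outcome Q F \<sigma> \<tau>)) ` strategies You Q F))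
      ` strategies Me Q F) \<le> back_value Q F f"
    using \<sigma> by (subst Min_le_iff) (auto simp: finite_strategies)
next
  obtain \<tau> where \<tau>: "\<tau> \<in> strategies You Q F" and
    opt: "\<And>v. v \<in> leaves Q F \<Longrightarrow> (\<forall>w\<in>nodes Q F. prefix (fst w) (fst v) \<longrightarrow> w \<in> \<tau>) \<Longrightarrow>
      back_value Q F f \<le> f v"
    using optimal_strategy[of You Q F f] by auto
  have "back_value Q F f \<le> Max ((\<lambda>\<tau>. f (outcome Q F \<sigma> \<tau>)) ` strategies You Q F)"
    if "\<sigma> \<in> strategies Me Q F" for \<sigma>
  proof -
    have "back_value Q F f \<le> f (outcome Q F \<sigma> \<tau>)"
      using is_outcome_outcome[OF that \<tau>] by (intro opt) (auto simp: is_outcome_def)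
    then show ?thesis
      using \<tau> by (subst Max_ge_iff) (auto simp: finite_strategies)
  qed
  then show "back_value Q F f \<le>
      Min ((\<lambda>\<sigma>. Max ((\<lambda>\<tau>. f (outcome Q F \<sigma> \<tau>)) ` strategies You Q F)) ` strategies Me Q F)"
    by (subst Min_ge_iff) (auto simp: finite_strategies strategies_nonempty)
qed


section \<open>Lengths of improving chains\<close>

lemma fst_embed [simp]: "fst (embed i v) = i # fst v"
  by (simp add: embed_def)

lemma snd_embed [simp]: "snd (embed i v) = snd v"
  by (simp add: embed_def)

text \<open>Being labelled by a variable survives \<open>embed\<close>, which changes the address
  alone, and the root of a compound formula is never so labelled.\<close>

lemma leaves_simps:
  fixes a :: 'a and G G1 G2 :: "'a qcl"
  shows "leaves Q (Var a) = {([], Q, Var a)}"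
  "leaves Q (Neg G) = embed 0 ` leaves (dual Q) G"
  "leaves Q (Conj G1 G2) = embed 0 ` leaves Q G1 \<union> embed 1 ` leaves Q G2"
  "leaves Q (Disj G1 G2) = embed 0 ` leaves Q G1 \<union> embed 1 ` leaves Q G2"
  "leaves Q (OrdDisj G1 G2) = embed 0 ` leaves Q G1 \<union> embed 1 ` leaves Q G2"
proof -
  let ?P = "\<lambda>v :: 'a node. \<exists>a. snd (snd v) = Var a"
  have embed: "{v \<in> embed i ` A. ?P v} = embed i ` {v \<in> A. ?P v}" for i A
  proof -
    have "{v \<in> embed i ` A. ?P v} = embed i ` {v \<in> A. ?P (embed i v)}" by blast
    then show ?thesis by (simp only: snd_embed)
  qed
  have un: "{v \<in> insert r (A \<union> B). ?P v} = {v \<in> A. ?P v} \<union> {v \<in> B. ?P v}"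
    if "\<not> ?P r" for r A B
    using that by blast
  have ins: "{v \<in> insert r A. ?P v} = {v \<in> A. ?P v}" if "\<not> ?P r" for r A
    using that by blast
  show "leaves Q (Var a) = {([], Q, Var a)}"
    unfolding leaves_eq nodes.simps by (simp add: set_eq_iff del: split_paired_All) (metis snd_conv)
  show "leaves Q (Neg G) = embed 0 ` leaves (dual Q) G"
    unfolding leaves_eq nodes.simps by (subst ins) (simp_all add: embed)
  show "leaves Q (Conj G1 G2) = embed 0 ` leaves Q G1 \<union> embed 1 ` leaves Q G2"
    unfolding leaves_eq nodes.simps by (subst un) (simp_all add: embed)
  show "leaves Q (Disj G1 G2) = embed 0 ` leaves Q G1 \<union> embed 1 ` leaves Q G2"
    unfolding leaves_eq nodes.simps by (subst un) (simp_all add: embed)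
  show "leaves Q (OrdDisj G1 G2) = embed 0 ` leaves Q G1 \<union> embed 1 ` leaves Q G2"
    unfolding leaves_eq nodes.simps by (subst un) (simp_all add: embed)
qed

text \<open>The closed form of \<open>pi_length\<close> at leaves. Below a binary root the address
  of a leaf starts with 0 or 1, so \<open>hd p\<close> tells the branch; negation gives 1 because
  its preference relation is empty.\<close>

fun rank :: "'a qcl \<Rightarrow> nat list \<Rightarrow> nat" where
  "rank (Var a) p = 1"
| "rank (Neg F) p = 1"
| "rank (Conj F G) p = (if hd p = 0 then rank F (tl p) else rank G (tl p))"
| "rank (Disj F G) p = (if hd p = 0 then rank F (tl p) else rank G (tl p))"
| "rank (OrdDisj F G) p = (if hd p = 0 then rank F (tl p) else opt F + rank G (tl p))"

lemma rank_pos: "rank F p > 0"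
  by (induction F arbitrary: p) auto

text \<open>Together with \<open>rank_pos\<close> this places all ranks in the first branch of an
  ordered disjunction strictly below those in the second.\<close>

lemma rank_le_opt: "rank F p \<le> opt F"
  by (induction F arbitrary: p) (auto simp: le_max_iff_disj trans_le_add1)

lemma leaves_nonempty: "leaves Q F \<noteq> {}"
  by (induction F arbitrary: Q) (auto simp: leaves_simps)

text \<open>The bound \<open>opt F\<close> is attained in the branch of larger optionality for
  \<open>Conj\<close> and \<open>Disj\<close>, and in the second branch for
  \<open>OrdDisj\<close>.\<close>

lemma ex_leaf_rank_opt: "\<exists>v\<in>leaves Proponent F. rank F (fst v) = opt F"
proof (induction F)
  case (Neg F)
  then show ?case using leaves_nonempty[of Proponent "Neg F"] by auto
next
  case (Conj F1 F2)
  then show ?case by (force simp: leaves_simps embed_def max_def)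
next
  case (Disj F1 F2)
  then show ?case by (force simp: leaves_simps embed_def max_def)
next
  case (OrdDisj F1 F2)
  then show ?case by (force simp: leaves_simps embed_def)
qed (auto simp: leaves_simps)

lemma pref_rank_less: "(v, w) \<in> pref Proponent F \<Longrightarrow> rank F (fst w) < rank F (fst v)"
proof (induction F arbitrary: v w)
  case (OrdDisj F1 F2)
  \<comment> \<open>This settles the pairs that cross from the second branch to the first; all
    others come from the induction hypotheses.\<close>
  have "rank F1 p < opt F1 + rank F2 q" for p q
    using rank_le_opt[of F1 p] rank_pos[of F2 q] by linarith
  then show ?case using OrdDisj by (auto simp: embed_rel_def embed_def)
qed (auto simp: embed_rel_def embed_def)

text \<open>The rank drops at each step and is still positive at the last element.\<close>

lemma pref_chain_length_le_rank:
  assumes "successively (\<lambda>x y. (x, y) \<in> pref Proponent F) vs" "vs \<noteq> []"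
  shows "length vs \<le> rank F (fst (hd vs))"
  using assms
proof (induction vs rule: induct_list012)
  case (2 x)
  then show ?case using rank_pos[of F "fst x"] by simp
next
  case (3 x y zs)
  then show ?case using pref_rank_less[of x y F] by simp
qed simp

lemma pref_chain_distinct:
  assumes "successively (\<lambda>x y. (x, y) \<in> pref Proponent F) vs"
  shows "distinct vs"
proof -
  have "successively (\<lambda>x y. rank F (fst y) < rank F (fst x)) vs"
    using assms by (rule successively_mono) (auto dest: pref_rank_less)
  then have "sorted_wrt (\<lambda>x y. rank F (fst y) < rank F (fst x)) vs"
    by (subst (asm) successively_conv_sorted_wrt) (auto simp: transp_def)
  then show ?thesis by (induction vs) auto
qed

text \<open>Chains of a branch are transported by \<open>embed\<close>. A chain in the second branch
  of an ordered disjunction is continued into the first, gaining \<open>opt F1\<close>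
  leaves.\<close>

lemma ex_pref_chain_of_rank_length:
  assumes "v \<in> leaves Proponent F"
  shows "\<exists>vs. vs \<noteq> [] \<and> hd vs = v \<and> set vs \<subseteq> leaves Proponent F \<and>
    successively (\<lambda>x y. (x, y) \<in> pref Proponent F) vs \<and> length vs = rank F (fst v)"
    (is "\<exists>vs. ?chain F v vs")
  using assms
proof (induction F arbitrary: v)
  case (Var a)
  then show ?case by (intro exI[of _ "[v]"]) auto
next
  case (Neg F)
  then show ?case by (intro exI[of _ "[v]"]) auto
next
  case (Conj F1 F2)
  from Conj.prems consider u where "v = embed 0 u" "u \<in> leaves Proponent F1"
    | u where "v = embed 1 u" "u \<in> leaves Proponent F2"
    by (auto simp: leaves_simps)
  then show ?case
  proof cases
    case 1
    then obtain vs where "?chain F1 u vs" using Conj.IH by blast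
    then have "?chain (Conj F1 F2) v (map (embed 0) vs)"
      using 1 by (auto simp: leaves_simps hd_map successively_map embed_rel_def embed_def
        elim!: successively_mono)
    then show ?thesis ..
  next
    case 2
    then obtain vs where "?chain F2 u vs" using Conj.IH by blast
    then have "?chain (Conj F1 F2) v (map (embed 1) vs)"
      using 2 by (auto simp: leaves_simps hd_map successively_map embed_rel_def embed_def
        elim!: successively_mono)
    then show ?thesis ..
  qed
next
  case (Disj F1 F2)
  from Disj.prems consider u where "v = embed 0 u" "u \<in> leaves Proponent F1"
    | u where "v = embed 1 u" "u \<in> leaves Proponent F2"
    by (auto simp: leaves_simps)
  then show ?case
  proof cases
    case 1
    then obtain vs where "?chain F1 u vs" using Disj.IH by blast
    then have "?chain (Disj F1 F2) v (map (embed 0) vs)"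
      using 1 by (auto simp: leaves_simps hd_map successively_map embed_rel_def embed_def
        elim!: successively_mono)
    then show ?thesis ..
  next
    case 2
    then obtain vs where "?chain F2 u vs" using Disj.IH by blast
    then have "?chain (Disj F1 F2) v (map (embed 1) vs)"
      using 2 by (auto simp: leaves_simps hd_map successively_map embed_rel_def embed_def
        elim!: successively_mono)
    then show ?thesis ..
  qed
next
  case (OrdDisj F1 F2)
  from OrdDisj.prems consider u where "v = embed 0 u" "u \<in> leaves Proponent F1"
    | u where "v = embed 1 u" "u \<in> leaves Proponent F2"
    by (auto simp: leaves_simps)
  then show ?case
  proof cases
    case 1
    then obtain vs where "?chain F1 u vs" using OrdDisj.IH by blast
    then have "?chain (OrdDisj F1 F2) v (map (embed 0) vs)"
      using 1 by (auto simp: leaves_simps hd_map successively_map embed_rel_def embed_def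
        elim!: successively_mono)
    then show ?thesis ..
  next
    case 2
    then obtain vs where vs: "?chain F2 u vs" using OrdDisj.IH by blast
    \<comment> \<open>A leaf of maximal rank, so that the induction hypothesis yields a continuation
      of length \<open>opt F1\<close>.\<close>
    obtain t where "t \<in> leaves Proponent F1" "rank F1 (fst t) = opt F1"
      using ex_leaf_rank_opt by blast
    then obtain ws where ws: "?chain F1 t ws" "length ws = opt F1"
      using OrdDisj.IH by metis
    let ?R = "\<lambda>x y. (x, y) \<in> pref Proponent (OrdDisj F1 F2)"
    have "successively ?R (map (embed 1) vs)" "successively ?R (map (embed 0) ws)"
      using vs ws by (auto simp: successively_map embed_rel_def elim!: successively_mono)
    \<comment> \<open>Any leaf of the second branch may be followed by any leaf of the first, so the
      two chains can be joined.\<close>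
    moreover have "?R (last (map (embed 1) vs)) (hd (map (embed 0) ws))"
    proof -
      have "last vs \<in> leaves Proponent F2" "hd ws \<in> leaves Proponent F1"
        using vs ws(1) last_in_set[of vs] hd_in_set[of ws] by blast+
      then show ?thesis using vs ws(1) by (simp add: hd_map last_map)
    qed
    ultimately have "successively ?R (map (embed 1) vs @ map (embed 0) ws)"
      by (simp add: successively_append_iff)
    moreover have "rank (OrdDisj F1 F2) (fst v) = opt F1 + rank F2 (fst u)"
      using 2 by (simp add: embed_def)
    ultimately have "?chain (OrdDisj F1 F2) v (map (embed 1) vs @ map (embed 0) ws)"
      using 2 vs ws by (auto simp: leaves_simps hd_map)
    then show ?thesis ..
  qed
qed

lemma pi_length_eq_rank:
  assumes "v \<in> leaves Proponent F"
  shows "pi_length Proponent F v = rank F (fst v)"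
  unfolding pi_length_def
proof (rule Max_eqI)
  show "finite {length vs | vs. vs \<noteq> [] \<and> hd vs = v \<and> distinct vs \<and>
      set vs \<subseteq> leaves Proponent F \<and> successively (\<lambda>x y. (x, y) \<in> pref Proponent F) vs}"
    by (rule finite_subset[of _ "{..rank F (fst v)}"])
      (auto dest: pref_chain_length_le_rank)
next
  show "rank F (fst v) \<in> {length vs | vs. vs \<noteq> [] \<and> hd vs = v \<and> distinct vs \<and>
      set vs \<subseteq> leaves Proponent F \<and> successively (\<lambda>x y. (x, y) \<in> pref Proponent F) vs}"
  proof -
    obtain vs where vs: "vs \<noteq> []" "hd vs = v" "set vs \<subseteq> leaves Proponent F"
      "successively (\<lambda>x y. (x, y) \<in> pref Proponent F) vs" "length vs = rank F (fst v)"
      using ex_pref_chain_of_rank_length[OF assms] by blast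
    then show ?thesis using pref_chain_distinct[OF vs(4)]
      by (intro CollectI exI[of _ vs] conjI) simp_all
  qed
qed (auto dest: pref_chain_length_le_rank)


section \<open>The value of the game\<close>

text \<open>Only values at leaves enter. This permits replacing \<open>pi_length\<close> by
  \<open>rank\<close>, whose agreement is established at leaves.\<close>

lemma back_value_cong:
  assumes "\<And>v. v \<in> leaves Q F \<Longrightarrow> f v = g v"
  shows "back_value Q F f = back_value Q F g"
  using assms
proof (induction F arbitrary: Q f g)
  case (Var a)
  then show ?case by (simp add: leaves_simps)
next
  case (Neg F)
  have "back_value (dual Q) F (f \<circ> embed 0) = back_value (dual Q) F (g \<circ> embed 0)"
    by (rule Neg.IH) (auto intro: Neg.prems simp: leaves_simps)
  then show ?case by simp
next
  case (Conj F1 F2)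
  have "back_value Q F1 (f \<circ> embed 0) = back_value Q F1 (g \<circ> embed 0)"
    "back_value Q F2 (f \<circ> embed 1) = back_value Q F2 (g \<circ> embed 1)"
    by (rule Conj.IH; auto intro: Conj.prems simp: leaves_simps)+
  then show ?case by simp
next
  case (Disj F1 F2)
  have "back_value Q F1 (f \<circ> embed 0) = back_value Q F1 (g \<circ> embed 0)"
    "back_value Q F2 (f \<circ> embed 1) = back_value Q F2 (g \<circ> embed 1)"
    by (rule Disj.IH; auto intro: Disj.prems simp: leaves_simps)+
  then show ?case by simp
next
  case (OrdDisj F1 F2)
  have "back_value Q F1 (f \<circ> embed 0) = back_value Q F1 (g \<circ> embed 0)"
    "back_value Q F2 (f \<circ> embed 1) = back_value Q F2 (g \<circ> embed 1)"
    by (rule OrdDisj.IH; auto intro: OrdDisj.prems simp: leaves_simps)+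
  then show ?case by simp
qed

text \<open>Adding a constant is monotone and so commutes with \<open>min\<close> and
  \<open>max\<close>. This handles the offset \<open>opt F1\<close> on a second branch.\<close>

lemma back_value_add: "back_value Q F (\<lambda>v. c + f v) = c + back_value Q F f"
proof -
  have "mono ((+) c)" by (simp add: mono_def add_left_mono)
  then show ?thesis
    by (induction F arbitrary: Q f) (simp_all add: o_def max_of_mono min_of_mono)
qed

lemma true_leaf_embed [simp]: "true_leaf I (embed i v) \<longleftrightarrow> true_leaf I v"
proof -
  obtain p R H where "v = (p, R, H)" by (cases v)
  then show ?thesis by (cases R; cases H) (auto simp: embed_def)
qed

text \<open>With one payoff \<open>c\<close> for all true leaves the game is classical evaluation,
  finite degree standing for truth; the roles are exchanged at a negation.\<close>

lemma back_value_const_payoff: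
  "back_value Q F (\<lambda>v. if true_leaf I v then c else \<infinity>) =
     (if (deg I F < \<infinity>) = (Q = Proponent) then c else \<infinity>)"
proof (induction F arbitrary: Q)
  case (Var a)
  then show ?case by (cases Q) auto
next
  case (Neg F)
  then show ?case by (cases Q) (auto simp: o_def)
next
  case (Conj F1 F2)
  then show ?case by (cases Q) (auto simp: o_def)
next
  case (Disj F1 F2)
  then show ?case by (cases Q) (auto simp: o_def min_def)
next
  case (OrdDisj F1 F2)
  then show ?case by (cases Q) (auto simp: o_def)
qed

text \<open>The counterpart of \<open>rank_le_opt\<close> for degrees: a finite degree of the first
  branch is at least as good for Me as anything the second offers.\<close>

lemma deg_le_opt: "deg I F < \<infinity> \<Longrightarrow> deg I F \<le> enat (opt F)"
proof (induction F)
  case (Conj F1 F2)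
  then show ?case by (auto simp: max_def split: if_splits intro: order_trans)
next
  case (Disj F1 F2)
  then show ?case by (auto simp: min_def max_def split: if_splits intro: order_trans)
next
  case (OrdDisj F1 F2)
  then show ?case by (cases "deg I F1"; cases "deg I F2") auto
qed (auto simp: one_enat_def split: if_splits)

lemma back_value_rank_payoff:
  "back_value Proponent F (\<lambda>v. if true_leaf I v then enat (rank F (fst v)) else \<infinity>) = deg I F"
proof (induction F)
  case (Neg F)
  then show ?case by (auto simp: o_def back_value_const_payoff one_enat_def cong: if_cong)
next
  case (OrdDisj F1 F2)
  let ?f = "\<lambda>F v. if true_leaf I v then enat (rank F (fst v)) else \<infinity>"
  \<comment> \<open>False leaves keep the payoff \<infinity>, which absorbs the offset.\<close>
  have shift: "?f (OrdDisj F1 F2) \<circ> embed 0 = ?f F1"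
    "?f (OrdDisj F1 F2) \<circ> embed 1 = (\<lambda>v. enat (opt F1) + ?f F2 v)"
    by (auto simp: fun_eq_iff)
  have "back_value Proponent (OrdDisj F1 F2) (?f (OrdDisj F1 F2)) =
      min (deg I F1) (enat (opt F1) + deg I F2)"
    by (simp only: back_value.simps shift back_value_add OrdDisj) simp
  also have "\<dots> = deg I (OrdDisj F1 F2)"
  \<comment> \<open>A finite degree of \<open>F1\<close> is at most \<open>opt F1\<close> and
    attains the minimum. Otherwise the minimum is the shifted degree of \<open>F2\<close>, be it
    finite or \<infinity>.\<close>
  proof (cases "deg I F1 < \<infinity>")
    case True
    then have "deg I F1 \<le> enat (opt F1) + deg I F2"
      by (intro add_increasing2 deg_le_opt) simp_all
    then show ?thesis using True by (simp add: min_def)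
  qed simp
  finally show ?case .
qed (auto simp: o_def one_enat_def cong: if_cong)

theorem theorem1:
  fixes F :: "'a::infinite qcl" and I :: "'a set"
  shows "game_value Proponent F I = deg I F"
proof -
  have "game_value Proponent F I = back_value Proponent F (payoff Proponent F I)"
    unfolding game_value_def by (rule minimax_eq_back_value)
  also have "\<dots> = back_value Proponent F
      (\<lambda>v. if true_leaf I v then enat (rank F (fst v)) else \<infinity>)"
    by (rule back_value_cong) (simp add: payoff_def pi_length_eq_rank)
  also have "\<dots> = deg I F"
    by (rule back_value_rank_payoff)
  finally show ?thesis .
qed

end
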